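(* Let $D\in\mathbb{R}^{m\times n}$, let $\Omega\subset\{1,\dots,m\}\times\{1,\dots,n\}$, let $\delta\ge 0$, and let $\xi=\frac{1}{\sqrt{\max\{m,n\}}}$. If $(L^*,S^* )$ is an optimal solution to $$\min_{L,S\in\mathbb{R}^{m\times n}}\{\|L\|_*+\xi\|\pi_\Omega(S)\|_1:\ \|L+S-\pi_\Omega(D)\|_F\le\delta\},$$ then $(L^*,\pi_\Omega(S^* ))$ is an optimal solution to $$\min_{L,S\in\mathbb{R}^{m\times n}}\{\|L\|_*+\xi\|S\|_1:\ \|\pi_\Omega(L+S-D)\|_F\le\delta\}.$$
   Context: For $X\in\mathbb{R}^{m\times n}$: $\|X\|_*$ is the nuclear norm (sum of the singular values), $\|X\|_1:=\sum_{i,j}|X_{ij}|$ is the entrywise $\ell_1$-norm, and $\|X\|_F$ is the Frobenius norm. The projection $\pi_\Omega:\mathbb{R}^{m\times n}\to\mathbb{R}^{m\times n}$ is defined by $(\pi_\Omega(X))_{ij}=X_{ij}$ if $(i,j)\in\Omega$ and $(\pi_\Omega(X))_{ij}=0$ otherwise. An optimal solution is a feasible point attaining the minimum. *)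

theory Defs
  imports "HOL-Analysis.Analysis" "HOL-Computational_Algebra.Computational_Algebra"
begin

text \<open>
  An $m \times n$ real matrix is an element of \<open>real ^ 'n ^ 'm\<close> (rows indexed by \<open>'m\<close>, columns
  by \<open>'n\<close>), with $m$ = \<open>CARD('m)\<close> and $n$ = \<open>CARD('n)\<close>.
\<close>

definition char_polynomial :: "'a::comm_ring_1 ^ 'n ^ 'n \<Rightarrow> 'a poly" where
  "char_polynomial A = det (\<chi> i j. (if i = j then [:0, 1:] else 0) - [:A $ i $ j:])"

text \<open>
  The singular values of \<open>X\<close> are the square roots of the eigenvalues of $X^T X$, counted with
  multiplicity. There are $n$ of them here; if $n > m$, this is the usual list of $\min(m, n)$
  singular values padded with $n - m$ zeros.
\<close>
definition singular_values :: "real ^ 'n ^ 'm \<Rightarrow> real multiset" where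
  "singular_values X = image_mset sqrt (proots (char_polynomial (transpose X ** X)))"

definition nuclear_norm :: "real ^ 'n ^ 'm \<Rightarrow> real" where
  "nuclear_norm X = sum_mset (singular_values X)"

definition entrywise_l1_norm :: "real ^ 'n ^ 'm \<Rightarrow> real" where
  "entrywise_l1_norm X = (\<Sum>i\<in>UNIV. \<Sum>j\<in>UNIV. \<bar>X $ i $ j\<bar>)"

text \<open>The library norm on \<open>real ^ 'n ^ 'm\<close> is the Frobenius norm.\<close>
lemma norm_eq_frobenius:
  fixes X :: "real ^ 'n ^ 'm"
  shows "norm X = sqrt (\<Sum>i\<in>UNIV. \<Sum>j\<in>UNIV. (X $ i $ j)\<^sup>2)"
  by (simp add: norm_vec_def L2_set_def sum_nonneg)

definition proj :: "('m \<times> 'n) set \<Rightarrow> real ^ 'n ^ 'm \<Rightarrow> real ^ 'n ^ 'm" where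
  "proj \<Omega> X = (\<chi> i j. if (i, j) \<in> \<Omega> then X $ i $ j else 0)"

end

theory Submission
  imports Defs
begin

text \<open>
  The two problems treat the entries of \<open>S\<close> outside \<open>\<Omega>\<close> differently. In the first problem these
  entries cost nothing, so they can cancel whatever \<open>L\<close> does outside \<open>\<Omega>\<close>; in the second they are
  penalised, but the constraint ignores them. Points can therefore be carried from each problem to
  the other with the same \<open>L\<close>, hence the same nuclear norm, and with no increase in cost.

  If \<open>(L, S)\<close> is feasible for the first problem, then \<open>(L, proj \<Omega> S)\<close> is feasible for the second,
  because projecting the residual \<open>L + S - proj \<Omega> D\<close> does not increase its Frobenius norm; the two
  costs agree. If \<open>(L, S)\<close> is feasible for the second problem, overwrite \<open>S\<close> by \<open>- L\<close> outside
  \<open>\<Omega>\<close>: the residual in the first problem is then exactly \<open>proj \<Omega> (L + S - D)\<close>, and only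
  \<open>proj \<Omega> S\<close> is charged, which is at most the cost of \<open>S\<close> since \<open>\<xi> \<ge> 0\<close>. So the first map sends
  a minimiser of the first problem to a minimiser of the second.
\<close>

lemma norm_proj_le:
  fixes X :: "real ^ 'n ^ 'm"
  shows "norm (proj \<Omega> X) \<le> norm X"
  unfolding norm_eq_frobenius
  by (intro real_sqrt_le_mono sum_mono) (simp add: proj_def)

lemma entrywise_l1_norm_proj_le: "entrywise_l1_norm (proj \<Omega> X) \<le> entrywise_l1_norm X"
  unfolding entrywise_l1_norm_def
  by (intro sum_mono) (simp add: proj_def)

lemma proj_proj_residual: "proj \<Omega> (L + proj \<Omega> S - D) = proj \<Omega> (L + S - proj \<Omega> D)"
  by (simp add: proj_def vec_eq_iff)

text \<open>
  The matrix \<open>proj \<Omega> S - (L - proj \<Omega> L)\<close> agrees with \<open>S\<close> on \<open>\<Omega>\<close> and with \<open>- L\<close> off \<open>\<Omega>\<close>. Paired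
  with \<open>L\<close> it leaves no residual off \<open>\<Omega>\<close>, and the next lemma shows that this is free of charge.
\<close>
lemma residual_absorb_off_support:
  "L + (proj \<Omega> S - (L - proj \<Omega> L)) - proj \<Omega> D = proj \<Omega> (L + S - D)"
  by (simp add: proj_def vec_eq_iff)

lemma proj_absorb_off_support: "proj \<Omega> (proj \<Omega> S - (L - proj \<Omega> L)) = proj \<Omega> S"
  by (simp add: proj_def vec_eq_iff)

theorem theorem1p1:
  fixes D Lopt Sopt :: "real ^ 'n ^ 'm"
    and \<Omega> :: "('m \<times> 'n) set"
    and \<delta> \<xi> :: real
  assumes "\<delta> \<ge> 0"
    and "\<xi> = 1 / sqrt (real (max CARD('m) CARD('n)))"
    and "is_arg_min (\<lambda>(L, S). nuclear_norm L + \<xi> * entrywise_l1_norm (proj \<Omega> S))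
           (\<lambda>(L, S). norm (L + S - proj \<Omega> D) \<le> \<delta>) (Lopt, Sopt)"
  shows "is_arg_min (\<lambda>(L, S). nuclear_norm L + \<xi> * entrywise_l1_norm S)
           (\<lambda>(L, S). norm (proj \<Omega> (L + S - D)) \<le> \<delta>) (Lopt, proj \<Omega> Sopt)"
proof -
  have feasible: "norm (Lopt + Sopt - proj \<Omega> D) \<le> \<delta>"
    using assms(3) by (simp add: is_arg_min_linorder)
  have optimal: "nuclear_norm Lopt + \<xi> * entrywise_l1_norm (proj \<Omega> Sopt)
        \<le> nuclear_norm L + \<xi> * entrywise_l1_norm (proj \<Omega> S)"
      if "norm (L + S - proj \<Omega> D) \<le> \<delta>" for L S
    using assms(3) that by (auto simp: is_arg_min_linorder)
  have "norm (proj \<Omega> (Lopt + proj \<Omega> Sopt - D)) \<le> \<delta>"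
    using norm_proj_le feasible unfolding proj_proj_residual by (rule order_trans)
  moreover have "nuclear_norm Lopt + \<xi> * entrywise_l1_norm (proj \<Omega> Sopt)
      \<le> nuclear_norm L + \<xi> * entrywise_l1_norm S"
    if "norm (proj \<Omega> (L + S - D)) \<le> \<delta>" for L S
  proof -
    have "nuclear_norm Lopt + \<xi> * entrywise_l1_norm (proj \<Omega> Sopt)
        \<le> nuclear_norm L + \<xi> * entrywise_l1_norm (proj \<Omega> S)"
      using optimal[of L "proj \<Omega> S - (L - proj \<Omega> L)"] that
      by (simp only: residual_absorb_off_support proj_absorb_off_support)
    also have "\<dots> \<le> nuclear_norm L + \<xi> * entrywise_l1_norm S"
      using assms(2) by (intro add_left_mono mult_left_mono entrywise_l1_norm_proj_le) simp
    finally show ?thesis .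
  qed
  ultimately show ?thesis
    by (auto simp: is_arg_min_linorder)
qed

end
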